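(* In the setting described in the context, suppose that: (A1) there is one observational environment and there are $n$ interventional environments, in each of which exactly one node is intervened, and each node is intervened in exactly one of them; (A2) for every $i\in[n]$ and every $k\in\mathrm{pa}(i)$, the function $(z_i,z_{\mathrm{pa}(i)})\mapsto \frac{\partial}{\partial z_k}\frac{q_Z(z_i\mid z_{\mathrm{pa}(i)})}{p_Z(z_i\mid z_{\mathrm{pa}(i)})}$ is not identically zero; (A3) for every $i\in[n]$ and every $c\in\mathcal C_i=\{c\in\mathbb R^n:\exists j\in\overline{\mathrm{pa}}(i),\ c_j\neq 0\}$, it is not the case that $c^\top s_Z(Z)=c^\top s_Z^{m_i}(Z)$ almost surely under $Z\sim p_Z$. Then for every $U\in\mathcal U$, with $\hat Z=\hat Z(U,X)$, the score change matrix of the estimated latent variables is at least as dense as that of the true latent variables: $$\|\Delta_{\hat Z}(I_n)\|_0\ \ge\ \|\Delta_Z(I_n)\|_0 .$$ Furthermore, equality holds only if $$P_1(U)\cdot\Delta_{\hat Z}(I_n)=\Delta_Z(I_n),$$ where $P_1(U)\in\Pi$ is uniquely specified by $U$.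
   Context: Notation: $[n]=\{1,\dots,n\}$; $\Pi$ is the set of $n\times n$ permutation matrices; $\|A\|_0$ is the number of nonzero entries of $A$; $\mathrm{im}(A)$ is the column space; $U^{+}=(U^\top U)^{-1}U^\top$ for full-column-rank $U$; $I_n$ is the identity matrix. Setting. Let $d\ge n$ and $T\in\mathbb R^{d\times n}$ with $\mathrm{rank}(T)=n$. $Z=(Z_1,\dots,Z_n)^\top$ has density $p_Z$ on $\mathbb R^n$, $p_Z(z)\neq0$ for all $z$, factorizing along a DAG $\mathcal G_Z$ on $[n]$: $p_Z(z)=\prod_i p_Z(z_i\mid z_{\mathrm{pa}(i)})$; $\mathrm{pa}(i)$ is the set of parents of $i$ and $\overline{\mathrm{pa}}(i)=\mathrm{pa}(i)\cup\{i\}$. The observed vector is $X=TZ$. For each $i$ there is an interventional conditional density $q_Z(z_i\mid z_{\mathrm{pa}(i)})$ different from $p_Z(z_i\mid z_{\mathrm{pa}(i)})$ (for a hard intervention it does not depend on $z_{\mathrm{pa}(i)}$). All conditional densities are positive and continuously differentiable in all variables. Under (A1) there is a bijection $i\mapsto m_i$ of $[n]$ such that in environment $m_i$ exactly node $i$ is intervened, and the latent density is $p^{m_i}(z)=q_Z(z_i\mid z_{\mathrm{pa}(i)})\prod_{j\ne i}p_Z(z_j\mid z_{\mathrm{pa}(j)})$; $X=TZ$ in every environment. Candidates. $\mathcal U=\{U\in\mathbb R^{d\times n}:\mathrm{rank}(U)=n,\ UU^{+}x=x\ \forall x\in\mathrm{im}(T)\}$ and $\hat Z(U,X)=U^{+}X$.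 Scores: $s_Z=\nabla\log p_Z$, $s_Z^m=\nabla\log p^m$, and $s_{\hat Z}$, $s_{\hat Z}^m$ are the gradients of the log-densities (on $\mathbb R^n$) of $\hat Z(U,X)$ in the observational environment and in environment $m$. Change matrices. $\Delta_Z(A)\in\{0,1\}^{n\times n}$ (for $A\in\mathbb R^{n\times n}$) has $(i,m)$ entry $0$ if $[A s_Z(Z)]_i=[A s_Z^m(Z)]_i$ almost surely under $Z\sim p_Z$, and $1$ otherwise. $\Delta_{\hat Z}(A)$ is defined likewise with $s_{\hat Z},s_{\hat Z}^m$ and the observational law of $\hat Z$. For $U\in\mathcal U$, $H(U)=(T^{+}U)^\top\in\mathbb R^{n\times n}$, which is invertible; $P_1(U)\in\Pi$ is a permutation matrix, fixed once for each $U$, such that $P_1(U)H(U)$ has all diagonal entries nonzero (such a permutation matrix exists because $H(U)$ is invertible). *)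

theory Defs
  imports "HOL-Analysis.Analysis"
begin

text \<open>The index set \<open>[n]\<close> is a finite type \<open>'n\<close>, used both for nodes and for interventional
  environments; \<open>\<real>\<^sup>d\<close> is \<open>real^'d\<close>.\<close>

definition permutation_matrices :: "(real^'n^'n) set" where
  "permutation_matrices =
     {P. \<exists>\<pi>. \<pi> permutes UNIV \<and> P = (\<chi> i j. if j = \<pi> i then 1 else 0)}"

definition nnz :: "real^'n^'m \<Rightarrow> nat" where
  "nnz A = card {(i, j). A $ i $ j \<noteq> 0}"

text \<open>This is the Moore--Penrose inverse only for matrices of full column rank.\<close>

definition pinv :: "real^'n^'d \<Rightarrow> real^'d^'n" where
  "pinv U = matrix_inv (transpose U ** U) ** transpose U"

definition grad :: "('a::real_inner \<Rightarrow> real) \<Rightarrow> 'a \<Rightarrow> 'a" where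
  "grad f x = (THE D. GDERIV f x :> D)"

definition cont_diff :: "('a::real_inner \<Rightarrow> real) \<Rightarrow> bool" where
  "cont_diff f \<longleftrightarrow> (\<exists>D. (\<forall>x. GDERIV f x :> D x) \<and> continuous_on UNIV D)"

definition score :: "('a::real_inner \<Rightarrow> real) \<Rightarrow> 'a \<Rightarrow> 'a" where
  "score f = grad (\<lambda>x. ln (f x))"

lemma grad_eq:
  assumes "GDERIV f x :> D"
  shows "grad f x = D"
  unfolding grad_def
proof (rule the_equality)
  fix E assume "GDERIV f x :> E"
  with assms have "(\<lambda>h. h \<bullet> E) = (\<lambda>h. h \<bullet> D)"
    unfolding gderiv_def by (metis has_derivative_unique)
  then show "E = D"
    by (metis inner_commute vector_eq_rdot)
qed (fact assms)

text \<open>A pair \<open>(j, i) \<in> G\<close> is an edge from \<open>j\<close> to \<open>i\<close>.\<close>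

definition pa :: "('n \<times> 'n) set \<Rightarrow> 'n \<Rightarrow> 'n set" where
  "pa G i = {j. (j, i) \<in> G}"

definition pa_closed :: "('n \<times> 'n) set \<Rightarrow> 'n \<Rightarrow> 'n set" where
  "pa_closed G i = insert i (pa G i)"

text \<open>A conditional density \<open>f(z\<^sub>i | z\<^bsub>pa(i)\<^esub>)\<close> is represented as a function on the whole space that
  depends only on the coordinates in \<open>pa_closed G i\<close> and integrates to 1 over the \<open>i\<close>-th
  coordinate. For an acyclic \<open>G\<close>, the product of such functions over all nodes is a probability
  density on the whole space whose conditionals are its factors. Dependence on the parents is
  permitted but not required.\<close>

definition cond_density :: "('n \<times> 'n) set \<Rightarrow> 'n \<Rightarrow> (real^'n \<Rightarrow> real) \<Rightarrow> bool" where
  "cond_density G i f \<longleftrightarrow>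
     (\<forall>z. 0 < f z) \<and> cont_diff f \<and>
     (\<forall>z z'. (\<forall>j\<in>pa_closed G i. z $ j = z' $ j) \<longrightarrow> f z = f z') \<and>
     (\<forall>z. has_bochner_integral lborel (\<lambda>t. f (\<chi> j. if j = i then t else z $ j)) 1)"

definition obs_density :: "('n \<Rightarrow> real^'n \<Rightarrow> real) \<Rightarrow> real^'n \<Rightarrow> real" where
  "obs_density p z = (\<Prod>i\<in>UNIV. p i z)"

text \<open>\<open>tgt m\<close> is the set of nodes intervened in environment \<open>m\<close>.\<close>

definition int_density ::
    "('n \<Rightarrow> real^'n \<Rightarrow> real) \<Rightarrow> ('n \<Rightarrow> real^'n \<Rightarrow> real) \<Rightarrow> ('n \<Rightarrow> 'n set) \<Rightarrow>
     'n \<Rightarrow> real^'n \<Rightarrow> real" where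
  "int_density p q tgt m z = (\<Prod>i\<in>tgt m. q i z) * (\<Prod>j\<in>- tgt m. p j z)"

definition single_node_interventions :: "('n \<Rightarrow> 'n set) \<Rightarrow> bool" where
  "single_node_interventions tgt \<longleftrightarrow> (\<forall>m. \<exists>!i. i \<in> tgt m) \<and> (\<forall>i. \<exists>!m. i \<in> tgt m)"

definition env_of :: "('n \<Rightarrow> 'n set) \<Rightarrow> 'n \<Rightarrow> 'n" where
  "env_of tgt i = (THE m. i \<in> tgt m)"

definition law :: "('a::euclidean_space \<Rightarrow> real) \<Rightarrow> 'a measure" where
  "law f = density lborel (\<lambda>z. ennreal (f z))"

text \<open>Lebesgue densities are determined only up to null sets; the continuous version is unique.\<close>

definition cont_pdf :: "'a::euclidean_space measure \<Rightarrow> 'a \<Rightarrow> real" where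
  "cont_pdf \<mu> = (THE f. continuous_on UNIV f \<and> (\<forall>z. 0 \<le> f z) \<and> \<mu> = law f)"

lemma cont_pdf_law:
  fixes f :: "'a::euclidean_space \<Rightarrow> real"
  assumes "continuous_on UNIV f" "\<And>z. 0 \<le> f z"
  shows "cont_pdf (law f) = f"
  unfolding cont_pdf_def
proof (rule the_equality)
  fix g :: "'a \<Rightarrow> real"
  assume g: "continuous_on UNIV g \<and> (\<forall>z. 0 \<le> g z) \<and> law f = law g"
  have [measurable]: "f \<in> borel_measurable borel" "g \<in> borel_measurable borel"
    using assms g by (auto intro: borel_measurable_continuous_onI)
  have "AE z in lborel. ennreal (f z) = ennreal (g z)"
    using g by (intro iffD1[OF sigma_finite_measure.density_unique_iff]) (auto simp: law_def lborel.sigma_finite_measure_axioms)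
  then have "AE z in lborel. f z = g z"
    by eventually_elim (use assms g in auto)
  then have "negligible {z. f z \<noteq> g z}"
    unfolding negligible_iff_null_sets eventually_ae_filter
    by (auto intro: null_sets_subset null_sets_completionI completion.complete2)
  moreover have "open {z. f z \<noteq> g z}"
    using assms g by (intro open_Collect_neq) auto
  ultimately show "g = f"
    using open_not_negligible by fastforce
qed (use assms in auto)

definition law_X :: "real^'n^'d \<Rightarrow> (real^'n \<Rightarrow> real) \<Rightarrow> (real^'d) measure" where
  "law_X T f = distr (law f) borel (\<lambda>z. T *v z)"

definition law_Zhat :: "real^'n^'d \<Rightarrow> real^'n^'d \<Rightarrow> (real^'n \<Rightarrow> real) \<Rightarrow> (real^'n) measure" where
  "law_Zhat T U f = distr (law_X T f) borel (\<lambda>x. pinv U *v x)"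

definition candidates :: "real^'n^'d \<Rightarrow> (real^'n^'d) set" where
  "candidates T =
     {U. rank U = CARD('n) \<and> (\<forall>x\<in>range (\<lambda>z. T *v z). (U ** pinv U) *v x = x)}"

definition H :: "real^'n^'d \<Rightarrow> real^'n^'d \<Rightarrow> real^'n^'n" where
  "H T U = transpose (pinv T ** U)"

definition diagonalizing_choice ::
    "real^'n^'d \<Rightarrow> (real^'n^'d \<Rightarrow> real^'n^'n) \<Rightarrow> bool" where
  "diagonalizing_choice T P1 \<longleftrightarrow>
     (\<forall>U\<in>candidates T. P1 U \<in> permutation_matrices \<and> (\<forall>i. (P1 U ** H T U) $ i $ i \<noteq> 0))"

definition change_matrix ::
    "(real^'n) measure \<Rightarrow> (real^'n \<Rightarrow> real^'n) \<Rightarrow> ('n \<Rightarrow> real^'n \<Rightarrow> real^'n) \<Rightarrow>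
     real^'n^'n \<Rightarrow> real^'n^'n" where
  "change_matrix \<mu> s sm A =
     (\<chi> i m. if AE z in \<mu>. (A *v s z) $ i = (A *v sm m z) $ i then 0 else 1)"

definition Delta_Z ::
    "('n \<Rightarrow> real^'n \<Rightarrow> real) \<Rightarrow> ('n \<Rightarrow> real^'n \<Rightarrow> real) \<Rightarrow> ('n \<Rightarrow> 'n set) \<Rightarrow>
     real^'n^'n \<Rightarrow> real^'n^'n" where
  "Delta_Z p q tgt =
     change_matrix (law (obs_density p)) (score (obs_density p))
       (\<lambda>m. score (int_density p q tgt m))"

definition Delta_Zhat ::
    "real^'n^'d \<Rightarrow> real^'n^'d \<Rightarrow> ('n \<Rightarrow> real^'n \<Rightarrow> real) \<Rightarrow> ('n \<Rightarrow> real^'n \<Rightarrow> real) \<Rightarrow>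
     ('n \<Rightarrow> 'n set) \<Rightarrow> real^'n^'n \<Rightarrow> real^'n^'n" where
  "Delta_Zhat T U p q tgt =
     change_matrix (law_Zhat T U (obs_density p))
       (score (cont_pdf (law_Zhat T U (obs_density p))))
       (\<lambda>m. score (cont_pdf (law_Zhat T U (int_density p q tgt m))))"

lemma pinv_left_inverse:
  fixes T :: "real^'n^'d"
  assumes "rank T = CARD('n)"
  shows "pinv T ** T = mat 1"
proof -
  have inj: "inj ((*v) T)"
    using assms by (simp add: full_rank_injective)
  have "inj ((*v) (transpose T ** T))"
  proof (subst matrix_vector_mul_linear[THEN linear_injective_0], intro allI impI)
    fix x assume "(transpose T ** T) *v x = 0"
    then have "x \<bullet> (transpose T *v (T *v x)) = 0"
      by (simp add: matrix_vector_mul_assoc)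
    then have "(T *v x) \<bullet> (T *v x) = 0"
      by (metis dot_lmul_matrix vector_transpose_matrix transpose_transpose inner_commute)
    then have "T *v x = T *v 0" by simp
    then show "x = 0" using inj by (blast dest: injD)
  qed
  then have "invertible (transpose T ** T)"
    by (simp add: invertible_left_inverse matrix_left_invertible_injective)
  then have "matrix_inv (transpose T ** T) ** (transpose T ** T) = mat 1"
    unfolding invertible_def matrix_inv_def by (rule someI2_ex) simp
  then show ?thesis
    by (simp add: pinv_def flip: matrix_mul_assoc)
qed

lemma invertible_H:
  fixes T U :: "real^'n^'d"
  assumes "rank T = CARD('n)" "U \<in> candidates T"
  shows "invertible (H T U)"
proof -
  have "(U ** pinv U) ** T = T"
    using assms(2) by (auto simp: candidates_def matrix_eq simp flip: matrix_vector_mul_assoc)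
  then have "(pinv T ** U) ** (pinv U ** T) = mat 1"
    by (metis matrix_mul_assoc pinv_left_inverse[OF assms(1)])
  then show ?thesis
    unfolding H_def by (simp add: invertible_det_nz det_transpose) (metis invertible_det_nz invertible_right_inverse)
qed

lemma ex_diagonalizing_choice:
  fixes T :: "real^'n^'d"
  assumes "rank T = CARD('n)"
  shows "\<exists>P1. diagonalizing_choice T P1"
proof -
  have "\<exists>P\<in>permutation_matrices. \<forall>i. (P ** H T U) $ i $ i \<noteq> 0" if "U \<in> candidates T" for U
  proof -
    have "det (transpose (H T U)) \<noteq> 0"
      using invertible_H[OF assms that] by (simp add: invertible_det_nz)
    then obtain \<pi> where \<pi>: "\<pi> permutes UNIV" "(\<Prod>i\<in>UNIV. transpose (H T U) $ i $ \<pi> i) \<noteq> 0"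
      unfolding det_def by (metis (mono_tags, lifting) mem_Collect_eq mult_zero_right sum.neutral)
    define P :: "real^'n^'n" where "P = (\<chi> i j. if j = \<pi> i then 1 else 0)"
    have "(P ** H T U) $ i $ i = H T U $ \<pi> i $ i" for i
      by (simp add: P_def matrix_matrix_mult_def if_distrib[of "\<lambda>x. x * _"] cong: if_cong)
    with \<pi> have "\<forall>i. (P ** H T U) $ i $ i \<noteq> 0"
      by (simp add: transpose_def)
    with \<pi> show ?thesis
      by (auto simp: permutation_matrices_def P_def)
  qed
  then show ?thesis
    unfolding diagonalizing_choice_def by metis
qed

end

theory Submission
  imports Defs
begin

text \<open>Write \<open>H\<close> for \<open>H T U\<close> and \<open>Z'\<close> for the estimated latent vector. Since \<open>Z = H\<^sup>T Z'\<close>, the score of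
  \<open>Z'\<close> is \<open>H\<close> applied to the score of \<open>Z\<close>, in every environment. Hence entry \<open>(i, m)\<close> of the change
  matrix of \<open>Z'\<close> tests whether row \<open>i\<close> of \<open>H\<close> annihilates the score difference in environment \<open>m\<close>.
  That difference is supported on the closed parent set of the intervened node \<open>l\<close>, so the change
  matrix of \<open>Z\<close> can be nonzero at \<open>(i, m)\<close> only if \<open>i\<close> lies in that set. By (A3) the change matrix
  of \<open>Z'\<close> is nonzero at \<open>(k, m)\<close> whenever row \<open>k\<close> of \<open>H\<close> has a nonzero entry in that set. The
  permutation moves a row with nonzero \<open>i\<close>-th entry to position \<open>i\<close>, so the support of the permuted
  matrix contains the support of the change matrix of \<open>Z\<close>.\<close>

section \<open>Gradients and scores of continuously differentiable functions\<close>

lemma GDERIV_grad: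
  assumes "cont_diff f"
  shows "GDERIV f x :> grad f x"
  using assms unfolding cont_diff_def by (metis grad_eq)

lemma continuous_on_grad:
  assumes "cont_diff f"
  shows "continuous_on UNIV (grad f)"
  using assms unfolding cont_diff_def by (metis ext grad_eq)

lemma cont_diff_imp_continuous_on:
  assumes "cont_diff f"
  shows "continuous_on UNIV f"
  using assms unfolding cont_diff_def gderiv_def
  by (meson continuous_at_imp_continuous_on has_derivative_continuous)

lemma cont_diff_mult:
  assumes "cont_diff f" "cont_diff g"
  shows "cont_diff (\<lambda>x. f x * g x)"
  unfolding cont_diff_def
proof (intro exI conjI allI)
  show "GDERIV (\<lambda>x. f x * g x) x :> f x *\<^sub>R grad g x + g x *\<^sub>R grad f x" for x
    by (intro GDERIV_mult GDERIV_grad assms)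
  show "continuous_on UNIV (\<lambda>x. f x *\<^sub>R grad g x + g x *\<^sub>R grad f x)"
    by (intro continuous_intros cont_diff_imp_continuous_on continuous_on_grad assms)
qed

lemma cont_diff_const: "cont_diff (\<lambda>x. c)"
  unfolding cont_diff_def by (intro exI[of _ "\<lambda>_. 0"]) (simp add: GDERIV_const)

lemma cont_diff_prod:
  assumes "\<And>i. i \<in> I \<Longrightarrow> cont_diff (f i)"
  shows "cont_diff (\<lambda>x. \<Prod>i\<in>I. f i x)"
  using assms
  by (induction I rule: infinite_finite_induct) (simp_all add: cont_diff_const cont_diff_mult)

lemma GDERIV_ln:
  assumes "GDERIV f x :> D" "0 < f x"
  shows "GDERIV (\<lambda>x. ln (f x)) x :> D /\<^sub>R f x"
  using GDERIV_DERIV_compose[OF assms(1) DERIV_ln[OF assms(2)]] .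

lemma cont_diff_ln:
  assumes "cont_diff f" "\<And>x. 0 < f x"
  shows "cont_diff (\<lambda>x. ln (f x))"
  unfolding cont_diff_def
proof (intro exI conjI allI)
  show "GDERIV (\<lambda>x. ln (f x)) x :> grad f x /\<^sub>R f x" for x
    by (intro GDERIV_ln GDERIV_grad assms)
  have "f x \<noteq> 0" for x
    using assms(2)[of x] by simp
  then show "continuous_on UNIV (\<lambda>x. grad f x /\<^sub>R f x)"
    by (intro continuous_intros cont_diff_imp_continuous_on continuous_on_grad assms) auto
qed

lemma continuous_on_score:
  assumes "cont_diff f" "\<And>x. 0 < f x"
  shows "continuous_on UNIV (score f)"
  unfolding score_def by (intro continuous_on_grad cont_diff_ln assms)

text \<open>On the line through \<open>z\<close> in the \<open>k\<close>-th coordinate direction,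
  \<open>f\<close> is constant, so by the chain rule its derivative in that direction
  vanishes.\<close>

lemma GDERIV_zero_component:
  fixes f :: "real^'n::finite \<Rightarrow> real"
  assumes D: "GDERIV f z :> D"
    and f: "\<And>w w'. (\<forall>j. j \<noteq> k \<longrightarrow> w $ j = w' $ j) \<Longrightarrow> f w = f w'"
  shows "D $ k = 0"
proof -
  have "((\<lambda>t. z + t *\<^sub>R axis k 1) has_derivative (\<lambda>t. t *\<^sub>R axis k (1::real))) (at 0)"
    by (auto intro!: derivative_eq_intros)
  moreover have "(f has_derivative (\<lambda>h. h \<bullet> D)) (at (z + 0 *\<^sub>R axis k 1))"
    using D by (simp add: gderiv_def)
  ultimately have "(f \<circ> (\<lambda>t. z + t *\<^sub>R axis k 1) has_derivative (\<lambda>h. h \<bullet> D) \<circ> (\<lambda>t. t *\<^sub>R axis k 1)) (at 0)"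
    by (rule diff_chain_at)
  moreover have "f \<circ> (\<lambda>t. z + t *\<^sub>R axis k 1) = (\<lambda>t. f z)"
  proof
    show "(f \<circ> (\<lambda>t. z + t *\<^sub>R axis k 1)) t = f z" for t
      unfolding comp_apply by (rule f) (simp add: axis_def)
  qed
  ultimately have "((\<lambda>t::real. f z) has_derivative (\<lambda>h. h \<bullet> D) \<circ> (\<lambda>t. t *\<^sub>R axis k 1)) (at 0)"
    by simp
  then have "(\<lambda>h. h \<bullet> D) \<circ> (\<lambda>t. t *\<^sub>R axis k 1) = (\<lambda>t. 0::real)"
    by (rule has_derivative_unique) (rule has_derivative_const)
  from fun_cong[OF this, of 1] show ?thesis
    by (simp add: inner_axis')
qed

text \<open>The chain rule turns \<open>A\<close> into its transpose acting on the gradient, while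
  the factor \<open>c\<close> contributes only the constant \<open>ln c\<close> to the
  logarithm.\<close>

lemma score_linear_image:
  fixes f :: "real^'n::finite \<Rightarrow> real" and A :: "real^'n^'n"
  assumes "cont_diff f" "\<And>x. 0 < f x" "0 < c"
  shows "score (\<lambda>y. c * f (A *v y)) y = transpose A *v score f (A *v y)"
proof -
  have "((\<lambda>y. ln (f (A *v y))) has_derivative (\<lambda>h. (A *v h) \<bullet> score f (A *v y))) (at y)"
    using GDERIV_grad[OF cont_diff_ln[OF assms(1,2)], of "A *v y"]
    unfolding gderiv_def score_def
    by (rule has_derivative_compose[rotated])
       (rule bounded_linear_imp_has_derivative, rule matrix_vector_mul_bounded_linear)
  then have "((\<lambda>y. ln c + ln (f (A *v y))) has_derivative (\<lambda>h. (A *v h) \<bullet> score f (A *v y))) (at y)"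
    using has_derivative_add[OF has_derivative_const] by fastforce
  moreover have "(\<lambda>y. ln c + ln (f (A *v y))) = (\<lambda>y. ln (c * f (A *v y)))"
    using assms(2,3) by (intro ext ln_mult_pos[symmetric])
  moreover have "(A *v h) \<bullet> w = h \<bullet> (transpose A *v w)" for h w
    by (metis dot_lmul_matrix inner_commute vector_transpose_matrix)
  ultimately show ?thesis
    unfolding score_def by (intro grad_eq) (simp add: gderiv_def)
qed

text \<open>Positivity of \<open>f\<close> gives \<open>law f\<close> the null sets of Lebesgue
  measure. Two continuous functions disagree on an open set, and a nonempty open set is not null.
  The almost sure tests in the change matrices thereby become pointwise.\<close>

lemma AE_law_continuous_eq_iff:
  fixes f g h :: "'a::euclidean_space \<Rightarrow> real"
  assumes f: "continuous_on UNIV f" "\<And>x. 0 < f x"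
    and g: "continuous_on UNIV g" and h: "continuous_on UNIV h"
  shows "(AE z in law f. g z = h z) \<longleftrightarrow> (\<forall>z. g z = h z)"
proof
  assume *: "AE z in law f. g z = h z"
  have [measurable]: "f \<in> borel_measurable borel"
    using f by (auto intro: borel_measurable_continuous_onI)
  have "AE z in lborel. g z = h z"
    using * f(2) unfolding law_def by (subst (asm) AE_density) auto
  then have "negligible {z. g z \<noteq> h z}"
    unfolding negligible_iff_null_sets eventually_ae_filter
    by (auto intro: null_sets_subset null_sets_completionI completion.complete2)
  moreover have "open {z. g z \<noteq> h z}"
    using g h by (intro open_Collect_neq) auto
  ultimately show "\<forall>z. g z = h z"
    using open_not_negligible by fastforce
qed auto

section \<open>Linear images of Lebesgue measure\<close>

lemma nn_integral_lborel_translate: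
  fixes a :: "'a::euclidean_space"
  assumes [measurable]: "f \<in> borel_measurable borel"
  shows "(\<integral>\<^sup>+y. f (a + y) \<partial>lborel) = (\<integral>\<^sup>+y. f y \<partial>lborel)"
proof -
  have "lborel = distr lborel borel ((+) a)"
    using lborel_affine[of 1 a] by (simp add: density_1)
  then have "(\<integral>\<^sup>+y. f y \<partial>lborel) = (\<integral>\<^sup>+y. f y \<partial>distr lborel borel ((+) a))"
    by simp
  then show ?thesis
    by (simp add: nn_integral_distr)
qed

lemma nn_integral_lborel_reflect:
  fixes a :: "'a::euclidean_space"
  assumes [measurable]: "f \<in> borel_measurable borel"
  shows "(\<integral>\<^sup>+y. f (a - y) \<partial>lborel) = (\<integral>\<^sup>+y. f y \<partial>lborel)"
proof -
  have "lborel = distr lborel borel ((-) a)"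
    using lborel_affine[of "-1" a] by (simp add: density_1)
  then have "(\<integral>\<^sup>+y. f y \<partial>lborel) = (\<integral>\<^sup>+y. f y \<partial>distr lborel borel ((-) a))"
    by simp
  then show ?thesis
    by (simp add: nn_integral_distr)
qed

text \<open>The change of variables theorems of the library require a well-ordered index type. Scores are
  invariant under scaling a density, so the value of the Jacobian is irrelevant here, and uniqueness
  of translation-invariant measures suffices. Uniqueness follows by evaluating the integral of
  \<open>indicator C x * indicator E (x + y)\<close> over \<open>x\<close> and \<open>y\<close> in both orders, where \<open>C\<close> is the
  unit cube.\<close>

lemma translation_invariant_measure_eq:
  fixes M :: "'a::euclidean_space measure"
  assumes sets[measurable_cong]: "sets M = sets borel"
    and fin: "\<And>K. compact K \<Longrightarrow> emeasure M K < \<infinity>"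
    and inv: "\<And>a. distr M borel ((+) a) = M"
  shows "M = density lborel (\<lambda>_. emeasure M (cbox 0 One))"
proof (rule measure_eqI)
  let ?C = "cbox 0 One :: 'a set"
  interpret M: sigma_finite_measure M
  proof
    have "(\<Union>n::nat. cball (0::'a) n) = UNIV"
      by (auto intro: real_arch_simple)
    moreover have "emeasure M (cball 0 r) \<noteq> \<infinity>" for r
      using fin[OF compact_cball, of 0 r] by auto
    ultimately show "\<exists>A. countable A \<and> A \<subseteq> sets M \<and> \<Union>A = space M \<and> (\<forall>a\<in>A. emeasure M a \<noteq> \<infinity>)"
      using sets_eq_imp_space_eq[OF sets]
      by (intro exI[of _ "range (\<lambda>n::nat. cball (0::'a) n)"]) (auto simp: sets)
  qed
  interpret pair_sigma_finite M "lborel :: 'a measure" ..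
  have M_translate: "(\<integral>\<^sup>+x. f (a + x) \<partial>M) = (\<integral>\<^sup>+x. f x \<partial>M)"
    if [measurable]: "f \<in> borel_measurable borel" for f :: "'a \<Rightarrow> ennreal" and a
  proof -
    have "(\<integral>\<^sup>+x. f x \<partial>M) = (\<integral>\<^sup>+x. f x \<partial>distr M borel ((+) a))"
      by (simp add: inv)
    then show ?thesis
      by (simp add: nn_integral_distr)
  qed
  fix E assume "E \<in> sets M"
  then have [measurable]: "E \<in> sets borel"
    by (simp add: sets)
  have "emeasure M ?C * emeasure lborel E = (\<integral>\<^sup>+x. \<integral>\<^sup>+y. indicator ?C x * indicator E y \<partial>lborel \<partial>M)"
    by (simp add: nn_integral_cmult nn_integral_multc sets)
  also have "\<dots> = (\<integral>\<^sup>+x. \<integral>\<^sup>+y. indicator ?C x * indicator E (x + y) \<partial>lborel \<partial>M)"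
    by (intro nn_integral_cong nn_integral_lborel_translate[symmetric]) simp
  also have "\<dots> = (\<integral>\<^sup>+y. \<integral>\<^sup>+x. indicator ?C x * indicator E (x + y) \<partial>M \<partial>lborel)"
    by (rule Fubini'[symmetric]) measurable
  also have "\<dots> = (\<integral>\<^sup>+y. \<integral>\<^sup>+x. indicator ?C (x - y) * indicator E x \<partial>M \<partial>lborel)"
  proof (rule nn_integral_cong)
    fix y :: 'a
    show "(\<integral>\<^sup>+x. indicator ?C x * indicator E (x + y) \<partial>M) = (\<integral>\<^sup>+x. indicator ?C (x - y) * indicator E x \<partial>M)"
      using M_translate[of "\<lambda>x. indicator ?C (x - y) * indicator E x" y] by (simp add: add.commute)
  qed
  also have "\<dots> = (\<integral>\<^sup>+x. \<integral>\<^sup>+y. indicator ?C (x - y) * indicator E x \<partial>lborel \<partial>M)"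
    by (rule Fubini') measurable
  \<comment> \<open>For fixed \<open>x\<close>, the reflection \<open>y\<close> to
    \<open>x - y\<close> preserves Lebesgue measure, so the inner integral is the volume of the unit
    cube, which is 1.\<close>
  also have "\<dots> = (\<integral>\<^sup>+x. (\<integral>\<^sup>+y. indicator ?C y \<partial>lborel) * indicator E x \<partial>M)"
    by (intro nn_integral_cong) (simp add: nn_integral_multc nn_integral_lborel_reflect[of "indicator ?C"])
  also have "\<dots> = emeasure M E"
    by (simp add: nn_integral_cmult emeasure_lborel_cbox_eq sets)
  finally show "emeasure M E = emeasure (density lborel (\<lambda>_. emeasure M ?C)) E"
    by (simp add: emeasure_density_const)
qed (simp add: sets)

text \<open>The image measure is translation-invariant and finite on compact sets because
  \<open>A\<close> is linear with inverse \<open>B\<close>. Hence it is a multiple of Lebesgue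
  measure, the factor being its mass on the unit cube.\<close>

lemma distr_lborel_matrix:
  fixes A B :: "real^'n::finite^'n"
  assumes AB: "A ** B = mat 1"
  obtains c where "0 < c" "distr lborel borel ((*v) A) = density lborel (\<lambda>_. ennreal c)"
proof -
  let ?M = "distr lborel borel ((*v) A)"
  let ?c = "emeasure ?M (cbox 0 One)"
  have BA: "B ** A = mat 1"
    using AB by (simp add: matrix_left_right_inverse)
  have [measurable]: "(*v) A \<in> borel_measurable borel"
    by (intro borel_measurable_continuous_onI linear_continuous_on matrix_vector_mul_bounded_linear)
  have vimage: "(*v) A -` S = (*v) B ` S" for S
    using AB BA by (force simp: matrix_vector_mul_assoc image_iff)
  have fin: "emeasure ?M K < \<infinity>" if "compact K" for K
  proof -
    have "compact ((*v) B ` K)"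
      by (intro compact_continuous_image that linear_continuous_on matrix_vector_mul_bounded_linear)
    then show ?thesis
      using emeasure_compact_finite that by (simp add: emeasure_distr borel_compact vimage)
  qed
  have "distr ?M borel ((+) a) = ?M" for a
  proof -
    \<comment> \<open>A translation by \<open>B *v a\<close> before \<open>A\<close> is a
      translation by \<open>a\<close> after it.\<close>
    have "lborel = distr lborel borel ((+) (B *v a))"
      using lborel_affine[of 1 "B *v a"] by (simp add: density_1)
    then have "?M = distr (distr lborel borel ((+) (B *v a))) borel ((*v) A)"
      by simp
    also have "\<dots> = distr lborel borel (\<lambda>x. a + A *v x)"
      by (subst distr_distr) (auto simp: o_def matrix_vector_right_distrib matrix_vector_mul_assoc AB)
    also have "\<dots> = distr ?M borel ((+) a)"
      by (subst distr_distr) (auto simp: o_def)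
    finally show ?thesis ..
  qed
  then have eq: "?M = density lborel (\<lambda>_. ?c)"
    using fin by (intro translation_invariant_measure_eq) auto
  \<comment> \<open>Infinite total mass excludes \<open>?c = 0\<close>, since 0 times infinity is 0
    in \<open>ennreal\<close>.\<close>
  have "emeasure ?M UNIV = \<infinity>"
    by (simp add: emeasure_distr)
  moreover have "emeasure ?M UNIV = ?c * \<infinity>"
    by (subst eq) (simp add: emeasure_density_const)
  ultimately have "?c \<noteq> 0"
    by auto
  moreover have "?c \<noteq> top"
    using fin[of "cbox 0 One"] by (simp add: less_top)
  ultimately have "0 < enn2real ?c" "ennreal (enn2real ?c) = ?c"
    by (auto simp: enn2real_positive_iff less_top zero_less_iff_neq_zero)
  with eq show thesis
    by (metis that)
qed

text \<open>Writing \<open>z\<close> as \<open>B *v (A *v z)\<close> makes the density a function of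
  \<open>A *v z\<close>, so it passes through the push-forward; the image of Lebesgue measure
  supplies \<open>c\<close>.\<close>

lemma distr_law_matrix:
  fixes A B :: "real^'n::finite^'n"
  assumes AB: "A ** B = mat 1"
  obtains c where "0 < c"
    "\<And>f. continuous_on UNIV f \<Longrightarrow> (\<And>x. 0 < f x) \<Longrightarrow>
      distr (law f) borel ((*v) A) = law (\<lambda>y. c * f (B *v y))"
proof -
  obtain c where c: "0 < c" "distr lborel borel ((*v) A) = density lborel (\<lambda>_. ennreal c)"
    using distr_lborel_matrix[OF AB] .
  have BA: "B ** A = mat 1"
    using AB by (simp add: matrix_left_right_inverse)
  have "distr (law f) borel ((*v) A) = law (\<lambda>y. c * f (B *v y))"
    if f: "continuous_on UNIV f" "\<And>x. 0 < f x" for f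
  proof -
    have [measurable]: "(*v) A \<in> borel_measurable borel" "(*v) B \<in> borel_measurable borel"
      "f \<in> borel_measurable borel"
      using f
      by (auto intro!: borel_measurable_continuous_onI linear_continuous_on matrix_vector_mul_bounded_linear)
    have "distr (law f) borel ((*v) A) =
        distr (density lborel (\<lambda>z. ennreal (f (B *v (A *v z))))) borel ((*v) A)"
      by (simp add: law_def matrix_vector_mul_assoc BA)
    also have "\<dots> = density (distr lborel borel ((*v) A)) (\<lambda>y. ennreal (f (B *v y)))"
      by (subst density_distr) auto
    also have "\<dots> = law (\<lambda>y. c * f (B *v y))"
      unfolding c(2) law_def
      using c(1) by (subst density_density_eq) (auto simp: ennreal_mult less_imp_le f)
    finally show ?thesis .
  qed
  with c(1) show thesis
    by (rule that)
qed

section \<open>Law and score of the estimated latent vector\<close>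

text \<open>The matrix \<open>pinv U ** T\<close> takes the latent vector to its estimate. As
  \<open>U ** pinv U\<close> fixes the range of \<open>T\<close>, it cancels in
  \<open>pinv T ** U ** pinv U ** T\<close>, which leaves the identity.\<close>

lemma pinv_candidate_inverse:
  fixes T U :: "real^'n::finite^'d::finite"
  assumes "rank T = CARD('n)" "U \<in> candidates T"
  shows "(pinv U ** T) ** transpose (H T U) = mat 1"
proof -
  have "(U ** pinv U) ** T = T"
    using assms(2) by (auto simp: candidates_def matrix_eq simp flip: matrix_vector_mul_assoc)
  then have "(pinv T ** U) ** (pinv U ** T) = mat 1"
    by (metis matrix_mul_assoc pinv_left_inverse[OF assms(1)])
  then show ?thesis
    by (simp add: H_def matrix_left_right_inverse)
qed

lemma law_Zhat_eq:
  fixes T U :: "real^'n::finite^'d::finite"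
  assumes "rank T = CARD('n)" "U \<in> candidates T"
  obtains c where "0 < c"
    "\<And>f. continuous_on UNIV f \<Longrightarrow> (\<And>x. 0 < f x) \<Longrightarrow>
      law_Zhat T U f = law (\<lambda>y. c * f (transpose (H T U) *v y))"
proof -
  have [measurable]: "(*v) T \<in> borel_measurable borel" "(*v) (pinv U) \<in> borel_measurable borel"
    by (auto intro!: borel_measurable_continuous_onI linear_continuous_on matrix_vector_mul_bounded_linear)
  have "law_Zhat T U f = distr (law f) borel ((*v) (pinv U ** T))" for f
    unfolding law_Zhat_def law_X_def
    by (subst distr_distr) (auto simp: law_def o_def matrix_vector_mul_assoc)
  then show thesis
    using distr_law_matrix[OF pinv_candidate_inverse[OF assms]] that by metis
qed

lemma score_cont_pdf_law_Zhat:
  fixes T U :: "real^'n::finite^'d::finite"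
  assumes "rank T = CARD('n)" "U \<in> candidates T" and f: "cont_diff f" "\<And>x. 0 < f x"
  shows "score (cont_pdf (law_Zhat T U f)) y = H T U *v score f (transpose (H T U) *v y)"
proof -
  have cf: "continuous_on UNIV f"
    by (rule cont_diff_imp_continuous_on) fact
  obtain c where c: "0 < c" "law_Zhat T U f = law (\<lambda>y. c * f (transpose (H T U) *v y))"
    using law_Zhat_eq[OF assms(1,2)] cf f(2) by metis
  have "continuous_on UNIV (\<lambda>y. c * f (transpose (H T U) *v y))"
    by (intro continuous_intros continuous_on_compose2[OF cf] linear_continuous_on
        matrix_vector_mul_bounded_linear) auto
  then have "cont_pdf (law_Zhat T U f) = (\<lambda>y. c * f (transpose (H T U) *v y))"
    unfolding c(2) using c(1) f(2) by (intro cont_pdf_law) (auto simp: less_imp_le)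
  then show ?thesis
    using score_linear_image[OF f c(1), of "transpose (H T U)" y] by (simp only: transpose_transpose)
qed

lemma change_matrix_Z_entry:
  fixes f :: "real^'n::finite \<Rightarrow> real"
  assumes "cont_diff f" "\<And>x. 0 < f x" "cont_diff (g m)" "\<And>x. 0 < g m x"
  shows "change_matrix (law f) (score f) (\<lambda>m. score (g m)) (mat 1) $ i $ m =
    (if \<forall>z. score f z $ i = score (g m) z $ i then 0 else 1)"
  unfolding change_matrix_def using assms
  by (simp add: AE_law_continuous_eq_iff continuous_on_component cont_diff_imp_continuous_on continuous_on_score)

text \<open>The almost sure test is first made pointwise in \<open>y\<close>; since
  \<open>transpose (H T U)\<close> is surjective, its values \<open>?B *v y\<close> then range over
  all \<open>z\<close>.\<close>

lemma change_matrix_Zhat_entry: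
  fixes T U :: "real^'n::finite^'d::finite" and f :: "real^'n \<Rightarrow> real"
  assumes TU: "rank T = CARD('n)" "U \<in> candidates T"
    and f: "cont_diff f" "\<And>x. 0 < f x" and g: "cont_diff (g m)" "\<And>x. 0 < g m x"
  shows "change_matrix (law_Zhat T U f) (score (cont_pdf (law_Zhat T U f)))
      (\<lambda>m. score (cont_pdf (law_Zhat T U (g m)))) (mat 1) $ i $ m =
    (if \<forall>z. H T U $ i \<bullet> score f z = H T U $ i \<bullet> score (g m) z then 0 else 1)"
proof -
  let ?h = "H T U" and ?B = "transpose (H T U)"
  have cf: "continuous_on UNIV f"
    by (rule cont_diff_imp_continuous_on) fact
  obtain c where c: "0 < c" "law_Zhat T U f = law (\<lambda>y. c * f (?B *v y))"
    using law_Zhat_eq[OF TU] cf f(2) by metis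
  have comp: "continuous_on UNIV (\<lambda>y. k (?B *v y))"
    if "continuous_on UNIV k" for k :: "real^'n \<Rightarrow> 'c::topological_space"
    by (intro continuous_on_compose2[OF that] linear_continuous_on matrix_vector_mul_bounded_linear) auto
  have inner: "continuous_on UNIV (\<lambda>y. ?h $ i \<bullet> score k (?B *v y))"
    if "cont_diff k" "\<And>x. 0 < k x" for k
    by (intro continuous_intros comp continuous_on_score that)
  have surj: "?B *v ((pinv U ** T) *v z) = z" for z
    using pinv_candidate_inverse[OF TU]
    by (metis matrix_left_right_inverse matrix_vector_mul_assoc matrix_vector_mul_lid)
  have "(AE y in law_Zhat T U f. ?h $ i \<bullet> score f (?B *v y) = ?h $ i \<bullet> score (g m) (?B *v y)) \<longleftrightarrow>
      (\<forall>y. ?h $ i \<bullet> score f (?B *v y) = ?h $ i \<bullet> score (g m) (?B *v y))"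
    unfolding c(2)
    using c(1) f(2) by (intro AE_law_continuous_eq_iff continuous_intros comp[OF cf] inner f g) auto
  also have "\<dots> \<longleftrightarrow> (\<forall>z. ?h $ i \<bullet> score f z = ?h $ i \<bullet> score (g m) z)"
    using surj by metis
  finally show ?thesis
    unfolding change_matrix_def
    by (simp add: score_cont_pdf_law_Zhat[OF TU] f g matrix_vector_mul_component)
qed

section \<open>Model densities and the support of score differences\<close>

lemma cont_diff_obs_density:
  assumes "\<And>i. cond_density G i (p i)"
  shows "cont_diff (obs_density p)"
  using assms unfolding obs_density_def cond_density_def by (intro cont_diff_prod) auto

lemma obs_density_pos:
  assumes "\<And>i. cond_density G i (p i)"
  shows "0 < obs_density p z"
  using assms unfolding obs_density_def cond_density_def by (intro prod_pos) auto

lemma cont_diff_int_density: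
  assumes "\<And>i. cond_density G i (p i)" "\<And>i. cond_density G i (q i)"
  shows "cont_diff (int_density p q tgt m)"
  using assms unfolding int_density_def cond_density_def
  by (intro cont_diff_mult cont_diff_prod) auto

lemma int_density_pos:
  assumes "\<And>i. cond_density G i (p i)" "\<And>i. cond_density G i (q i)"
  shows "0 < int_density p q tgt m z"
  using assms unfolding int_density_def cond_density_def
  by (intro mult_pos_pos prod_pos) auto

lemma score_cond_density_zero:
  assumes "cond_density G l f" "i \<notin> pa_closed G l"
  shows "score f z $ i = 0"
proof -
  have f: "cont_diff f" "\<And>z. 0 < f z"
    "\<And>w w'. (\<forall>j\<in>pa_closed G l. w $ j = w' $ j) \<Longrightarrow> f w = f w'"
    using assms(1) by (auto simp: cond_density_def)
  show ?thesis
    unfolding score_def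
  proof (rule GDERIV_zero_component[OF GDERIV_grad[OF cont_diff_ln[OF f(1,2)]]])
    fix w w' :: "real^'a"
    assume "\<forall>j. j \<noteq> i \<longrightarrow> w $ j = w' $ j"
    then have "f w = f w'"
      using assms(2) by (intro f(3)) metis
    then show "ln (f w) = ln (f w')"
      by simp
  qed
qed

text \<open>The two densities differ in the factor of node \<open>l\<close> only, and that factor does not involve
  coordinates outside \<open>pa_closed G l\<close>.\<close>

lemma score_int_density_eq:
  fixes p q :: "'n::finite \<Rightarrow> real^'n \<Rightarrow> real"
  assumes p: "\<And>i. cond_density G i (p i)" and q: "\<And>i. cond_density G i (q i)"
    and tgt: "tgt m = {l}" and i: "i \<notin> pa_closed G l"
  shows "score (obs_density p) z $ i = score (int_density p q tgt m) z $ i"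
proof -
  have pp: "0 < p j x" "0 < q j x" for j x
    using p q by (auto simp: cond_density_def)
  have cd: "cont_diff (p j)" "cont_diff (q j)" for j
    using p q by (auto simp: cond_density_def)
  have o: "obs_density p x = p l x * (\<Prod>j\<in>-{l}. p j x)" for x
    unfolding obs_density_def by (simp add: prod.remove[of UNIV l] Compl_eq_Diff_UNIV)
  have prod_pos': "0 < (\<Prod>j\<in>-{l}. p j x)" for x
    by (intro prod_pos) (use pp in auto)
  have "ln (int_density p q tgt m x) = ln (obs_density p x) + ln (q l x) - ln (p l x)" for x
    using pp prod_pos' by (simp add: o int_density_def tgt ln_mult_pos)
  moreover have "GDERIV (\<lambda>x. ln (obs_density p x) + ln (q l x) - ln (p l x)) z :>
      score (obs_density p) z + score (q l) z - score (p l) z"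
    unfolding score_def
    by (intro GDERIV_diff GDERIV_add GDERIV_grad cont_diff_ln cd pp
        cont_diff_obs_density[of G] obs_density_pos[of G] p)
  ultimately have "score (int_density p q tgt m) z =
      score (obs_density p) z + score (q l) z - score (p l) z"
    unfolding score_def[of "int_density p q tgt m"] by (intro grad_eq) simp
  then show ?thesis
    using score_cond_density_zero[OF p i] score_cond_density_zero[OF q i] by simp
qed

section \<open>Row permutations and the comparison of supports\<close>

lemma permutation_matrix_mult_component:
  "((\<chi> i j. if j = \<pi> i then 1 else 0) ** A :: real^'m::finite^'n::finite) $ i $ m = A $ \<pi> i $ m"
  by (simp add: matrix_matrix_mult_def if_distrib[of "\<lambda>x. x * _"] cong: if_cong)

lemma nnz_permute_rows:
  fixes A :: "real^'m::finite^'n::finite"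
  assumes "\<pi> permutes UNIV"
  shows "nnz (\<chi> i m. A $ \<pi> i $ m) = nnz A"
proof -
  have "{(i, j). A $ \<pi> i $ j \<noteq> 0} = (\<lambda>(i, j). (\<pi> i, j)) -` {(i, j). A $ i $ j \<noteq> 0}"
    by auto
  moreover have "bij (\<lambda>(i, j :: 'm). (\<pi> i, j))"
    using bij_betw_map_prod[OF permutes_bij[OF assms] bij_id] by (simp add: map_prod_def)
  ultimately show ?thesis
    unfolding nnz_def using card_vimage_inj[of "\<lambda>(i, j :: 'm). (\<pi> i, j)" "{(i, j). A $ i $ j \<noteq> 0}"]
    by (simp only: bij_is_inj bij_is_surj vec_lambda_beta top_greatest)
qed

theorem lemma6:
  fixes G :: "('n::finite \<times> 'n) set"
    and p q :: "'n \<Rightarrow> real^'n \<Rightarrow> real"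
    and tgt :: "'n \<Rightarrow> 'n set"
    and T U :: "real^'n^'d::finite"
    and P1 :: "real^'n^'d \<Rightarrow> real^'n^'n"
  assumes dims: "CARD('n) \<le> CARD('d)"
    and T: "rank T = CARD('n)"
    and dag: "acyclic G"
    and p: "\<And>i. cond_density G i (p i)"
    and q: "\<And>i. cond_density G i (q i)"
    and q_neq_p: "\<And>i. q i \<noteq> p i"
    and P1: "diagonalizing_choice T P1"
    and A1: "single_node_interventions tgt"
    and A2: "\<And>i k. k \<in> pa G i \<Longrightarrow> \<exists>z. grad (\<lambda>w. q i w / p i w) z $ k \<noteq> 0"
    and A3: "\<And>i c. (\<exists>j\<in>pa_closed G i. c $ j \<noteq> 0) \<Longrightarrow>
               \<not> (AE z in law (obs_density p).
                    c \<bullet> score (obs_density p) z = c \<bullet> score (int_density p q tgt (env_of tgt i)) z)"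
    and U: "U \<in> candidates T"
  shows "nnz (Delta_Zhat T U p q tgt (mat 1)) \<ge> nnz (Delta_Z p q tgt (mat 1)) \<and>
         (nnz (Delta_Zhat T U p q tgt (mat 1)) = nnz (Delta_Z p q tgt (mat 1)) \<longrightarrow>
            P1 U ** Delta_Zhat T U p q tgt (mat 1) = Delta_Z p q tgt (mat 1))"
proof -
  let ?D = "Delta_Z p q tgt (mat 1)" and ?E = "Delta_Zhat T U p q tgt (mat 1)"
  note f = cont_diff_obs_density[OF p] obs_density_pos[OF p]
  note g = cont_diff_int_density[OF p q] int_density_pos[OF p q]
  obtain \<pi> where \<pi>: "\<pi> permutes UNIV" and P: "P1 U = (\<chi> i j. if j = \<pi> i then 1 else 0)"
    using P1 U unfolding diagonalizing_choice_def permutation_matrices_def by auto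
  have diag: "H T U $ \<pi> i $ i \<noteq> 0" for i
    using P1 U unfolding diagonalizing_choice_def by (metis P permutation_matrix_mult_component)
  have D: "?D $ i $ m = (if \<forall>z. score (obs_density p) z $ i = score (int_density p q tgt m) z $ i then 0 else 1)"
    for i m
    unfolding Delta_Z_def by (rule change_matrix_Z_entry) (rule f g)+
  have E: "?E $ i $ m = (if \<forall>z. H T U $ i \<bullet> score (obs_density p) z
      = H T U $ i \<bullet> score (int_density p q tgt m) z then 0 else 1)" for i m
    unfolding Delta_Zhat_def by (rule change_matrix_Zhat_entry[OF T U]) (rule f g)+
  have row: "?E $ \<pi> i $ m = 1" if "?D $ i $ m \<noteq> 0" for i m
  proof -
    obtain l where l: "tgt m = {l}"
      using A1 unfolding single_node_interventions_def by blast
    have m: "env_of tgt l = m"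
      using A1 l unfolding single_node_interventions_def env_of_def by (intro the1_equality) auto
    have "i \<in> pa_closed G l"
      using that score_int_density_eq[of G p q tgt m l i, OF p q l] unfolding D by metis
    \<comment> \<open>The witness is \<open>i\<close> itself: the choice of \<open>P1 U\<close>
      makes entry \<open>i\<close> of row \<open>\<pi> i\<close> nonzero.\<close>
    then have "\<exists>j\<in>pa_closed G l. H T U $ \<pi> i $ j \<noteq> 0"
      using diag by blast
    from A3[OF this] show ?thesis
      unfolding E m by auto
  qed
  define E' :: "real^'n^'n" where "E' = (\<chi> i m. ?E $ \<pi> i $ m)"
  have PE: "P1 U ** ?E = E'"
    by (simp add: vec_eq_iff P permutation_matrix_mult_component E'_def)
  have sub: "{(i, m). ?D $ i $ m \<noteq> 0} \<subseteq> {(i, m). E' $ i $ m \<noteq> 0}"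
    using row by (auto simp: E'_def)
  have nnz: "nnz ?E = nnz E'"
    unfolding E'_def by (rule nnz_permute_rows[OF \<pi>, symmetric])
  show ?thesis
  proof (intro conjI impI)
    show "nnz ?D \<le> nnz ?E"
      unfolding nnz unfolding nnz_def by (rule card_mono[OF _ sub]) simp
    assume "nnz ?E = nnz ?D"
    then have eq: "{(i, m). ?D $ i $ m \<noteq> 0} = {(i, m). E' $ i $ m \<noteq> 0}"
      unfolding nnz unfolding nnz_def by (intro card_subset_eq[OF _ sub]) auto
    \<comment> \<open>All entries of both matrices are 0 or 1, so equal supports force equal
      matrices.\<close>
    have "E' $ i $ m = ?D $ i $ m" for i m
    proof -
      have "E' $ i $ m \<noteq> 0 \<longleftrightarrow> ?D $ i $ m \<noteq> 0"
        using eq by (auto simp: set_eq_iff)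
      then show ?thesis
        by (auto simp: E'_def D E split: if_splits)
    qed
    then show "P1 U ** ?E = ?D"
      unfolding PE by (simp add: vec_eq_iff)
  qed
qed

end
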